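(* Let $k\ge 0$ and let ${}^kM$ be the $k$-th order extension of a Kaehlerian manifold $M$ with closed 2-form $\Phi$, with extended coordinates $(z_{ri},\overline z_{ri})$, $0\le r\le k$, $1\le i\le m$, equipped with the closed 2-form $\Phi^{c^k}=-\mathbf i\,d\overline z_{ri}\wedge dz_{ri}$. Let $H:\mathbf R\times M\to\mathbf C$ be a smooth function with $k$-th order complete lift $H^{c^k}:\mathbf R\times{}^kM\to\mathbf C$, and for $t\in\mathbf R$ put $H_t^{c^k}=H^{c^k}(t,\cdot)$. Then the $k$-th order complete lift $Z_t^{c^k}$ to ${}^kM$ of the Hamiltonian vector field, i.e. the vector field on ${}^kM$ determined by $i_{Z_t^{c^k}}\Phi^{c^k}=dH_t^{c^k}$, is given by $$Z_t^{c^k}=\frac{1}{\mathbf i}\frac{\partial H^{c^k}}{\partial\overline z_{ri}}\frac{\partial}{\partial z_{ri}}-\frac{1}{\mathbf i}\frac{\partial H^{c^k}}{\partial z_{ri}}\frac{\partial}{\partial\overline z_{ri}},$$ with summation over $0\le r\le k$ and $1\le i\le m$.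
   Context: All objects are smooth; repeated indices are summed; $\mathbf i=\sqrt{-1}$. Everything is expressed in a coordinate chart. $M$ has complex dimension $m$ and local complex coordinates $(z_{0i},\overline z_{0i})$, $1\le i\le m$. Its $k$-th order extension ${}^kM$ (with ${}^0M=M$) has local coordinates $(z_{ri},\overline z_{ri})$, $0\le r\le k$, $1\le i\le m$ (indices written up or down interchangeably); the projection ${}^kM\to{}^{k-1}M$ forgets the coordinates with $r=k$. Put $N=\mathbf R\times M$ and ${}^kN=\mathbf R\times{}^kM$, with coordinates $(t,z_{ri},\overline z_{ri})$. Vector fields are allowed to be complex, i.e. complex combinations of $\partial/\partial z_{ri}$ and $\partial/\partial\overline z_{ri}$ whose components along $\partial/\partial z_{ri}$ and $\partial/\partial\overline z_{ri}$ are determined independently. Lifts of functions: $v$ denotes pullback of a function from ${}^{k-1}N$ to ${}^kN$ along the projection. The complete lift of $f:N\to\mathbf C$ is defined recursively by $f^{c^0}=f$ and $$f^{c^k}=t\Big(\frac{\partial f^{c^{k-1}}}{\partial t}\Big)^{v}+\dot z^{ri}\Big(\frac{\partial f^{c^{k-1}}}{\partial z^{ri}}\Big)^{v}+\dot{\overline z}^{ri}\Big(\frac{\partial f^{c^{k-1}}}{\partial\overline z^{ri}}\Big)^{v},$$ with sums over $0\le r\le k-1$, $1\le i\le m$, where the dotted quantities are the coordinates $\dot z^{ri}=z^{(r+1)i}$, $\dot{\overline z}^{ri}=\overline z^{(r+1)i}$ of ${}^kN$. Forms: $\Phi=-\mathbf i\,d\overline z_{0i}\wedge dz_{0i}$ on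 $M$, and on ${}^kM$ the form $\Phi^{c^k}=-d\lambda^{c^k}$ with $\lambda^{c^k}=\frac12\mathbf i(-z_{ri}\,d\overline z_{ri}+\overline z_{ri}\,dz_{ri})$ (sum over $r$ and $i$). *)

theory Defs
  imports "HOL-Analysis.Analysis"
begin

text \<open>
  Everything lives in one coordinate chart, whose image is an open set \<open>U\<close> in \<open>complex ^ 'm\<close>.
  As the order \<open>k\<close> varies inside the recursion for the complete lift, a point of the \<open>k\<close>-th
  order extension is a function \<open>z\<close> on all of \<open>nat\<close> with \<open>z r $ i\<close> the coordinate
  \<open>z\<^sub>r\<^sub>i\<close> and \<open>z r = 0\<close> for \<open>r > k\<close>. With the product topology this set is homeomorphic to
  \<open>U\<close> times \<open>k\<close> copies of \<open>complex ^ 'm\<close>.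
\<close>

type_synonym 'm jet = "nat \<Rightarrow> complex ^ 'm"

definition extension :: "nat \<Rightarrow> (complex ^ ('m::finite)) set \<Rightarrow> 'm jet set" where
  "extension k U = {z. z 0 \<in> U \<and> (\<forall>r>k. z r = 0)}"

definition proj :: "nat \<Rightarrow> ('m::finite) jet \<Rightarrow> 'm jet" where
  "proj k z = (\<lambda>r. if r \<le> k then z r else 0)"

definition shift :: "nat \<Rightarrow> 'm \<Rightarrow> complex \<Rightarrow> 'm jet \<Rightarrow> ('m::finite) jet" where
  "shift r i w z = z(r := z r + axis i w)"

text \<open>
  Write \<open>z\<^sub>r\<^sub>i = x\<^sub>r\<^sub>i + \<i> y\<^sub>r\<^sub>i\<close>. The real partial derivatives with respect to
  \<open>x\<^sub>r\<^sub>i\<close> and \<open>y\<^sub>r\<^sub>i\<close> are \<open>part 1 r i\<close> and \<open>part \<i> r i\<close>.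
\<close>

definition part :: "complex \<Rightarrow> nat \<Rightarrow> 'm \<Rightarrow> (('m::finite) jet \<Rightarrow> complex) \<Rightarrow> 'm jet \<Rightarrow> complex" where
  "part c r i f z = vector_derivative (\<lambda>s::real. f (shift r i (s *\<^sub>R c) z)) (at 0)"

definition part_z :: "nat \<Rightarrow> 'm \<Rightarrow> (('m::finite) jet \<Rightarrow> complex) \<Rightarrow> 'm jet \<Rightarrow> complex" where
  "part_z r i f z = (part 1 r i f z - \<i> * part \<i> r i f z) / 2"

definition part_zbar :: "nat \<Rightarrow> 'm \<Rightarrow> (('m::finite) jet \<Rightarrow> complex) \<Rightarrow> 'm jet \<Rightarrow> complex" where
  "part_zbar r i f z = (part 1 r i f z + \<i> * part \<i> r i f z) / 2"

definition part_t :: "(real \<Rightarrow> 'm jet \<Rightarrow> complex) \<Rightarrow> real \<Rightarrow> 'm jet \<Rightarrow> complex" where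
  "part_t F t z = vector_derivative (\<lambda>s. F s z) (at t)"

text \<open>
  \<open>C\<^sup>n\<close> functions on the product of the real line with the \<open>k\<close>-th order extension: all iterated
  partial derivatives in the \<open>2m(k+1)+1\<close> real coordinates up to order \<open>n\<close> exist and are
  continuous. Only values on this product matter, since it is open in these coordinates.
\<close>

primrec cont_diff ::
  "nat \<Rightarrow> nat \<Rightarrow> (complex ^ 'm) set \<Rightarrow> (real \<Rightarrow> ('m::finite) jet \<Rightarrow> complex) \<Rightarrow> bool" where
  "cont_diff 0 k U F \<longleftrightarrow> continuous_on (UNIV \<times> extension k U) (\<lambda>(t, z). F t z)"
| "cont_diff (Suc n) k U F \<longleftrightarrow>
     continuous_on (UNIV \<times> extension k U) (\<lambda>(t, z). F t z) \<and>
     (\<forall>t. \<forall>z \<in> extension k U. (\<lambda>s. F s z) differentiable (at t)) \<and>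
     cont_diff n k U (part_t F) \<and>
     (\<forall>r\<le>k. \<forall>i. \<forall>c \<in> {1, \<i>}.
        (\<forall>t. \<forall>z \<in> extension k U.
           (\<lambda>s::real. F t (shift r i (s *\<^sub>R c) z)) differentiable (at 0)) \<and>
        cont_diff n k U (\<lambda>t. part c r i (F t)))"

definition smooth_time ::
  "nat \<Rightarrow> (complex ^ 'm) set \<Rightarrow> (real \<Rightarrow> ('m::finite) jet \<Rightarrow> complex) \<Rightarrow> bool" where
  "smooth_time k U F \<longleftrightarrow> (\<forall>n. cont_diff n k U F)"

text \<open>A function without time is smooth iff its pullback to the product with the real line is.\<close>

definition smooth :: "nat \<Rightarrow> (complex ^ 'm) set \<Rightarrow> (('m::finite) jet \<Rightarrow> complex) \<Rightarrow> bool" where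
  "smooth k U f \<longleftrightarrow> smooth_time k U (\<lambda>t. f)"

definition on_base :: "(real \<Rightarrow> complex ^ 'm \<Rightarrow> complex) \<Rightarrow> real \<Rightarrow> 'm jet \<Rightarrow> complex" where
  "on_base f t z = f t (z 0)"

text \<open>
  The partial derivatives of the previous lift are pulled back along \<open>proj\<close>. The time derivative
  carries the coordinate \<open>t\<close> itself as its coefficient.
\<close>

primrec complete_lift ::
  "nat \<Rightarrow> (real \<Rightarrow> complex ^ 'm \<Rightarrow> complex) \<Rightarrow> real \<Rightarrow> ('m::finite) jet \<Rightarrow> complex" where
  "complete_lift 0 f = on_base f"
| "complete_lift (Suc k) f = (\<lambda>t z.
     of_real t * part_t (complete_lift k f) t (proj k z)
     + (\<Sum>r\<le>k. \<Sum>i\<in>UNIV. z (Suc r) $ i * part_z r i (complete_lift k f t) (proj k z))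
     + (\<Sum>r\<le>k. \<Sum>i\<in>UNIV. cnj (z (Suc r) $ i) * part_zbar r i (complete_lift k f t) (proj k z)))"

text \<open>
  The pair \<open>(a, b)\<close> stands for the complex tangent vector with components \<open>a r $ i\<close> along
  \<open>\<partial>/\<partial>z\<^sub>r\<^sub>i\<close> and \<open>b r $ i\<close> along the conjugate direction; \<open>b\<close> need not be the conjugate
  of \<open>a\<close>.
\<close>

type_synonym 'm tvec = "'m jet \<times> 'm jet"

definition tangent :: "nat \<Rightarrow> ('m::finite) tvec set" where
  "tangent k = {v. \<forall>r>k. fst v r = 0 \<and> snd v r = 0}"

definition vec_of_components ::
  "nat \<Rightarrow> (nat \<Rightarrow> 'm \<Rightarrow> complex) \<Rightarrow> (nat \<Rightarrow> 'm \<Rightarrow> complex) \<Rightarrow> ('m::finite) tvec" where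
  "vec_of_components k a b =
     (\<lambda>r. if r \<le> k then \<chi> i. a r i else 0, \<lambda>r. if r \<le> k then \<chi> i. b r i else 0)"

definition vector_field ::
  "nat \<Rightarrow> (complex ^ 'm) set \<Rightarrow> (('m::finite) jet \<Rightarrow> 'm tvec) \<Rightarrow> bool" where
  "vector_field k U Z \<longleftrightarrow>
     (\<forall>z \<in> extension k U. Z z \<in> tangent k) \<and>
     (\<forall>r\<le>k. \<forall>i. smooth k U (\<lambda>z. fst (Z z) r $ i) \<and> smooth k U (\<lambda>z. snd (Z z) r $ i))"

type_synonym 'm covec = "'m tvec \<Rightarrow> complex"
type_synonym 'm bicovec = "'m tvec \<Rightarrow> 'm tvec \<Rightarrow> complex"

definition dz :: "nat \<Rightarrow> 'm \<Rightarrow> ('m::finite) covec" where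
  "dz r i v = fst v r $ i"

definition dzbar :: "nat \<Rightarrow> 'm \<Rightarrow> ('m::finite) covec" where
  "dzbar r i v = snd v r $ i"

definition wedge :: "'m covec \<Rightarrow> 'm covec \<Rightarrow> 'm bicovec" where
  "wedge \<alpha> \<beta> u v = \<alpha> u * \<beta> v - \<alpha> v * \<beta> u"

definition interior :: "'m tvec \<Rightarrow> 'm bicovec \<Rightarrow> 'm covec" where
  "interior u \<omega> v = \<omega> u v"

definition differential :: "nat \<Rightarrow> (('m::finite) jet \<Rightarrow> complex) \<Rightarrow> 'm jet \<Rightarrow> 'm covec" where
  "differential k f z v =
     (\<Sum>r\<le>k. \<Sum>i\<in>UNIV. part_z r i f z * dz r i v + part_zbar r i f z * dzbar r i v)"

text \<open>The form has constant coefficients, so it is given without a base point.\<close>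

definition Phi :: "nat \<Rightarrow> ('m::finite) bicovec" where
  "Phi k u v = - \<i> * (\<Sum>r\<le>k. \<Sum>i\<in>UNIV. wedge (dzbar r i) (dz r i) u v)"

definition hamiltonian_field ::
  "nat \<Rightarrow> (complex ^ 'm) set \<Rightarrow> (('m::finite) jet \<Rightarrow> complex) \<Rightarrow> ('m jet \<Rightarrow> 'm tvec) \<Rightarrow> bool" where
  "hamiltonian_field k U f Z \<longleftrightarrow>
     vector_field k U Z \<and>
     (\<forall>z \<in> extension k U. \<forall>v \<in> tangent k. interior (Z z) (Phi k) v = differential k f z v)"

text \<open>
  \<open>Phi\<close> agrees with minus the exterior derivative of \<open>liouville\<close>; in particular it is closed.
\<close>

definition liouville :: "nat \<Rightarrow> 'm jet \<Rightarrow> ('m::finite) covec" where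
  "liouville k z v =
     \<i> / 2 * (\<Sum>r\<le>k. \<Sum>i\<in>UNIV. - (z r $ i) * dzbar r i v + cnj (z r $ i) * dz r i v)"

text \<open>
  The usual formula for the exterior derivative of a 1-form, evaluated on the constant vector
  fields through \<open>u\<close> and \<open>v\<close>, whose Lie bracket vanishes.
\<close>

definition ext_deriv :: "nat \<Rightarrow> ('m jet \<Rightarrow> 'm covec) \<Rightarrow> ('m::finite) jet \<Rightarrow> 'm bicovec" where
  "ext_deriv k \<alpha> z u v = differential k (\<lambda>w. \<alpha> w v) z u - differential k (\<lambda>w. \<alpha> w u) z v"

lemma part_liouville:
  assumes "q \<le> k"
  shows "part c q j (\<lambda>w. liouville k w v) z =
           \<i> / 2 * (cnj c * dz q j v - c * dzbar q j v)"
proof -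
  let ?D = "cnj c * dz q j v - c * dzbar q j v"
  have summand: "- ((shift q j (s *\<^sub>R c) z) r $ i) * dzbar r i v
        + cnj ((shift q j (s *\<^sub>R c) z) r $ i) * dz r i v
      = (- (z r $ i) * dzbar r i v + cnj (z r $ i) * dz r i v)
        + (if r = q then if i = j then of_real s * ?D else 0 else 0)" for r i and s :: real
    by (auto simp: shift_def axis_def scaleR_conv_of_real algebra_simps)
  have collapse: "(\<Sum>r\<le>k. \<Sum>i\<in>UNIV.
        if r = q then if i = j then of_real s * ?D else 0 else 0) = of_real s * ?D" for s :: real
  proof -
    have "(\<Sum>r\<le>k. \<Sum>i\<in>UNIV. if r = q then if i = j then of_real s * ?D else 0 else 0)
        = (\<Sum>r\<le>k. if r = q then of_real s * ?D else 0)"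
      by (intro sum.cong refl) simp
    then show ?thesis using assms by simp
  qed
  have "liouville k (shift q j (s *\<^sub>R c) z) v = liouville k z v + s *\<^sub>R (\<i> / 2 * ?D)"
    for s :: real
    unfolding liouville_def summand sum.distrib collapse
    by (simp only: scaleR_conv_of_real distrib_left mult_ac)
  then show ?thesis
    unfolding part_def
    by (intro vector_derivative_at) (auto intro!: derivative_eq_intros)
qed

lemma Phi_eq_minus_ext_deriv: "Phi k u v = - ext_deriv k (liouville k) z u v"
proof -
  have "differential k (\<lambda>w. liouville k w x) z y =
      (\<Sum>r\<le>k. \<Sum>i\<in>UNIV. \<i> / 2 * (dz r i x * dzbar r i y - dzbar r i x * dz r i y))"
    for x y
    unfolding differential_def
  proof (intro sum.cong refl)
    fix r i assume "r \<in> {..k}"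
    then have "r \<le> k" by simp
    then have "part_z r i (\<lambda>w. liouville k w x) z = - (\<i> / 2) * dzbar r i x"
      "part_zbar r i (\<lambda>w. liouville k w x) z = \<i> / 2 * dz r i x"
      by (simp_all add: part_z_def part_zbar_def part_liouville field_simps)
    then show "part_z r i (\<lambda>w. liouville k w x) z * dz r i y
        + part_zbar r i (\<lambda>w. liouville k w x) z * dzbar r i y
        = \<i> / 2 * (dz r i x * dzbar r i y - dzbar r i x * dz r i y)"
      by (simp add: algebra_simps)
  qed
  then show ?thesis
    unfolding ext_deriv_def Phi_def wedge_def sum_distrib_left
    by (simp flip: sum_subtractf sum_negf)
       (intro sum.cong refl, simp add: field_simps)
qed

end

theory Submission
  imports Defs
begin

text \<open>
  Contracting \<open>Phi\<close> with the coordinate vectors reads off the components of a Hamiltonian field,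
  so only the smoothness of those components, that is of the complete lift, needs work. Being
  \<open>C\<^sup>n\<close> is preserved by sums, products and pullback along \<open>proj\<close>, and the lift is built from
  these operations, partial derivatives and coordinates.
\<close>

section \<open>Coordinate lines and genuine partial derivatives\<close>

lemma eventually_shift_in_extension:
  assumes "open U" "z \<in> extension k U" "r \<le> k"
  shows "\<forall>\<^sub>F s in nhds 0. shift r i (s *\<^sub>R c) z \<in> extension k U"
proof -
  have axis: "axis i (s *\<^sub>R c) = s *\<^sub>R axis i c" for s
    by (simp add: vec_eq_iff axis_def)
  \<comment> \<open>Only the order-0 coordinate is constrained by \<open>U\<close>. A shift with
    \<open>r > 0\<close> leaves it alone, so the openness of \<open>U\<close> matters just for
    \<open>r = 0\<close>, where the line through \<open>z 0\<close> must stay in \<open>U\<close>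
    for small \<open>s\<close>.\<close>
  have "((\<lambda>s. z 0 + s *\<^sub>R axis i c) \<longlongrightarrow> z 0 + 0 *\<^sub>R axis i c) (nhds (0::real))"
    by (intro tendsto_intros filterlim_ident)
  then have "\<forall>\<^sub>F s in nhds 0. z 0 + s *\<^sub>R axis i c \<in> U"
    using assms by (intro topological_tendstoD) (auto simp: extension_def)
  then show ?thesis
    by eventually_elim (use assms in \<open>auto simp: extension_def shift_def axis\<close>)
qed

text \<open>\<open>part_t\<close> and \<open>part\<close> rest on \<open>vector_derivative\<close>,
  a choice that means something only where a derivative exists. Here and in the next lemma the
  differentiability clauses of \<open>cont_diff\<close> make them genuine derivatives.\<close>

lemma has_vector_derivative_part_t:
  assumes "cont_diff (Suc n) k U F" "z \<in> extension k U"
  shows "((\<lambda>s. F s z) has_vector_derivative part_t F t z) (at t)"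
  using assms by (simp add: part_t_def vector_derivative_works[symmetric])

lemma has_vector_derivative_part:
  assumes "cont_diff (Suc n) k U F" "z \<in> extension k U" "r \<le> k" "c \<in> {1, \<i>}"
  shows "((\<lambda>s. F t (shift r i (s *\<^sub>R c) z)) has_vector_derivative part c r i (F t) z) (at 0)"
proof -
  have "(\<lambda>s. F t (shift r i (s *\<^sub>R c) z)) differentiable (at (0::real))"
    using assms unfolding cont_diff.simps by blast
  then show ?thesis
    by (simp add: part_def vector_derivative_works[symmetric])
qed

section \<open>General rules for functions of finite differentiability order\<close>

lemma cont_diff_imp_continuous:
  "cont_diff n k U F \<Longrightarrow> continuous_on (UNIV \<times> extension k U) (\<lambda>(t, z). F t z)"
  by (cases n) auto

lemma cont_diff_part_t: "cont_diff (Suc n) k U F \<Longrightarrow> cont_diff n k U (part_t F)"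
  by simp

lemma cont_diff_part:
  "cont_diff (Suc n) k U F \<Longrightarrow> r \<le> k \<Longrightarrow> c \<in> {1, \<i>} \<Longrightarrow> cont_diff n k U (\<lambda>t. part c r i (F t))"
  unfolding cont_diff.simps by blast

text \<open>Jets are total functions, but a partial derivative at a point of the extension probes
  only points of the extension: time lines keep \<open>z\<close> fixed, and short coordinate lines
  stay inside because \<open>U\<close> is open. So the partials of \<open>F\<close> and
  \<open>G\<close> agree there too, and the induction passes to them.\<close>

lemma cont_diff_cong:
  assumes "open U"
  shows "cont_diff n k U F \<Longrightarrow> (\<And>t z. z \<in> extension k U \<Longrightarrow> G t z = F t z) \<Longrightarrow> cont_diff n k U G"
proof (induction n arbitrary: F G)
  case 0
  then show ?case by (auto intro: continuous_on_eq)
next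
  case (Suc n)
  have t_der: "((\<lambda>s. G s z) has_vector_derivative part_t F t z) (at t)"
    if "z \<in> extension k U" for t z
    using has_vector_derivative_part_t[OF Suc.prems(1) that] Suc.prems(2)[OF that] by simp
  have z_der: "((\<lambda>s. G t (shift r i (s *\<^sub>R c) z)) has_vector_derivative part c r i (F t) z) (at 0)"
    if z: "z \<in> extension k U" and r: "r \<le> k" and c: "c \<in> {1, \<i>}" for t z r i c
  proof -
    \<comment> \<open>The filter \<open>nhds 0\<close> is not punctured, so it also supplies the
      agreement at \<open>s = 0\<close> that the derivative congruence asks for.\<close>
    have "\<forall>\<^sub>F s in nhds 0. G t (shift r i (s *\<^sub>R c) z) = F t (shift r i (s *\<^sub>R c) z)"
      using eventually_shift_in_extension[OF \<open>open U\<close> z r]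
      by eventually_elim (rule Suc.prems(2))
    then show ?thesis
      using has_vector_derivative_part[OF Suc.prems(1) z r c]
      by (subst has_vector_derivative_cong_ev[where g = "\<lambda>s. F t (shift r i (s *\<^sub>R c) z)"])
         (auto dest: eventually_nhds_x_imp_x elim: eventually_mono)
  qed
  show ?case
    unfolding cont_diff.simps
  proof (intro conjI allI ballI impI)
    show "continuous_on (UNIV \<times> extension k U) (\<lambda>(t, z). G t z)"
      using cont_diff_imp_continuous[OF Suc.prems(1)] Suc.prems(2)
      by (auto intro: continuous_on_eq)
    show "(\<lambda>s. G s z) differentiable (at t)" if "z \<in> extension k U" for t z
      using t_der[OF that] by (rule differentiableI_vector)
    show "cont_diff n k U (part_t G)"
      using cont_diff_part_t[OF Suc.prems(1)]
      by (rule Suc.IH) (use t_der in \<open>auto simp: part_t_def intro!: vector_derivative_at\<close>)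
    fix r i c assume rc: "r \<le> k" "c \<in> {1, \<i>}"
    show "(\<lambda>s. G t (shift r i (s *\<^sub>R c) z)) differentiable (at (0::real))"
      if "z \<in> extension k U" for t z
      using z_der[OF that rc] by (rule differentiableI_vector)
    show "cont_diff n k U (\<lambda>t. part c r i (G t))"
      using cont_diff_part[OF Suc.prems(1) rc]
    proof (rule Suc.IH)
      show "part c r i (G t) z = part c r i (F t) z" if "z \<in> extension k U" for t z
        using vector_derivative_at[OF z_der[OF that rc]] by (simp add: part_def)
    qed
  qed
qed

text \<open>The introduction rule behind the closure properties below: explicit candidates
  \<open>D\<close> and \<open>E\<close> for the partials may replace the
  \<open>vector_derivative\<close> terms, since they agree on the extension and
  \<open>cont_diff_cong\<close> transfers the regularity.\<close>

lemma cont_diff_SucI: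
  assumes "open U"
    and "continuous_on (UNIV \<times> extension k U) (\<lambda>(t, z). F t z)"
    and t_der: "\<And>t z. z \<in> extension k U \<Longrightarrow> ((\<lambda>s. F s z) has_vector_derivative D t z) (at t)"
    and "cont_diff n k U D"
    and z_der: "\<And>t z r i c. z \<in> extension k U \<Longrightarrow> r \<le> k \<Longrightarrow> c \<in> {1, \<i>} \<Longrightarrow>
      ((\<lambda>s. F t (shift r i (s *\<^sub>R c) z)) has_vector_derivative E c r i t z) (at 0)"
    and E: "\<And>r i c. r \<le> k \<Longrightarrow> c \<in> {1, \<i>} \<Longrightarrow> cont_diff n k U (E c r i)"
  shows "cont_diff (Suc n) k U F"
  unfolding cont_diff.simps
proof (intro conjI allI ballI impI)
  show "continuous_on (UNIV \<times> extension k U) (\<lambda>(t, z). F t z)" by fact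
  show "(\<lambda>s. F s z) differentiable (at t)" if "z \<in> extension k U" for t z
    using t_der[OF that] by (rule differentiableI_vector)
  show "cont_diff n k U (part_t F)"
    using \<open>open U\<close> \<open>cont_diff n k U D\<close>
    by (rule cont_diff_cong) (use t_der in \<open>auto simp: part_t_def intro!: vector_derivative_at\<close>)
  fix r i c assume rc: "r \<le> k" "c \<in> {1, \<i>}"
  show "(\<lambda>s. F t (shift r i (s *\<^sub>R c) z)) differentiable (at (0::real))"
    if "z \<in> extension k U" for t z
    using z_der[OF that rc] by (rule differentiableI_vector)
  show "cont_diff n k U (\<lambda>t. part c r i (F t))"
    using \<open>open U\<close> E[OF rc]
  proof (rule cont_diff_cong)
    show "part c r i (F t) z = E c r i t z" if "z \<in> extension k U" for t z
      using vector_derivative_at[OF z_der[OF that rc]] by (simp add: part_def)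
  qed
qed

text \<open>The recursion spends one order per derivative, so lowering the order is itself an
  induction: the partials of \<open>F\<close> drop one order by the induction hypothesis, and
  continuity is available at every order.\<close>

lemma cont_diff_SucD:
  assumes "open U"
  shows "cont_diff (Suc n) k U F \<Longrightarrow> cont_diff n k U F"
proof (induction n arbitrary: F)
  case 0
  then show ?case by simp
next
  case (Suc n)
  show ?case
    by (rule cont_diff_SucI[where D = "part_t F" and E = "\<lambda>c r i t. part c r i (F t)"])
       (intro assms cont_diff_imp_continuous[OF Suc.prems] has_vector_derivative_part_t[OF Suc.prems]
          has_vector_derivative_part[OF Suc.prems] Suc.IH cont_diff_part_t[OF Suc.prems]
          cont_diff_part[OF Suc.prems]; assumption)+
qed

section \<open>Constants, coordinates, sums and products\<close>

lemma cont_diff_const: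
  fixes U :: "(complex ^ 'a::finite) set"
  shows "cont_diff n k U (\<lambda>t z. a)"
proof (induction n arbitrary: a)
  case (Suc n)
  have "part_t (\<lambda>t z::'a jet. a) = (\<lambda>t z. 0)" "part c r i (\<lambda>z::'a jet. a) = (\<lambda>z. 0)" for c r i
    by (auto simp: part_t_def part_def fun_eq_iff)
  then show ?case
    using Suc by (simp add: case_prod_unfold)
qed (simp add: case_prod_unfold)

lemma cont_diff_time:
  assumes "open U"
  shows "cont_diff n k U (\<lambda>t z. of_real t)"
proof (cases n)
  case 0
  then show ?thesis by (auto simp: case_prod_unfold intro!: continuous_intros)
next
  case (Suc m)
  show ?thesis
    unfolding Suc
    by (rule cont_diff_SucI[where D = "\<lambda>t z. 1" and E = "\<lambda>c r i t z. 0"])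
       (auto simp: case_prod_unfold cont_diff_const assms
         intro!: continuous_intros derivative_eq_intros)
qed

text \<open>Taking \<open>l\<close> real-linear covers the coordinates and their conjugates at once.
  A real shift by \<open>s\<close> in direction \<open>c\<close> changes the value by
  \<open>s\<close> times \<open>l c\<close> or not at all, so all first partials are constants and a
  case distinction on \<open>n\<close> replaces induction.\<close>

lemma cont_diff_linear_coordinate:
  fixes l :: "complex \<Rightarrow> complex"
  assumes "open U" "bounded_linear l"
  shows "cont_diff n k U (\<lambda>t z. l (z q $ j))"
proof -
  interpret l: bounded_linear l by fact
  have cont: "continuous_on (UNIV \<times> extension k U) (\<lambda>(t::real, z). l (z q $ j))"
    unfolding case_prod_unfold
    by (intro l.continuous_on continuous_on_component
        continuous_on_product_then_coordinatewise[OF continuous_on_snd] continuous_on_id)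
  have shift: "l (shift r i (s *\<^sub>R c) z q $ j)
      = l (z q $ j) + s *\<^sub>R (if q = r \<and> j = i then l c else 0)" for r i s c z
    by (auto simp: shift_def axis_def l.add l.scaleR)
  show ?thesis
  proof (cases n)
    case (Suc m)
    show ?thesis
      unfolding Suc
      by (rule cont_diff_SucI[where D = "\<lambda>t z. 0"
            and E = "\<lambda>c r i t z. if q = r \<and> j = i then l c else 0"])
         (auto simp: shift cont_diff_const assms cont intro!: derivative_eq_intros)
  qed (use cont in simp)
qed

lemma cont_diff_add:
  assumes "open U"
  shows "cont_diff n k U F \<Longrightarrow> cont_diff n k U G \<Longrightarrow> cont_diff n k U (\<lambda>t z. F t z + G t z)"
proof (induction n arbitrary: F G)
  case 0
  then show ?case by (auto simp: case_prod_unfold intro: continuous_intros)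
next
  case (Suc n)
  note cont = Suc.prems[THEN cont_diff_imp_continuous]
  show ?case
  proof (rule cont_diff_SucI[where D = "\<lambda>t z. part_t F t z + part_t G t z"
        and E = "\<lambda>c r i t z. part c r i (F t) z + part c r i (G t) z"])
    show "continuous_on (UNIV \<times> extension k U) (\<lambda>(t, z). F t z + G t z)"
      using continuous_on_add[OF cont] by (simp add: case_prod_unfold)
    show "cont_diff n k U (\<lambda>t z. part_t F t z + part_t G t z)"
      by (rule Suc.IH[OF Suc.prems[THEN cont_diff_part_t]])
    show "cont_diff n k U (\<lambda>t z. part c r i (F t) z + part c r i (G t) z)"
      if "r \<le> k" "c \<in> {1, \<i>}" for c r i
      by (rule Suc.IH[OF cont_diff_part[OF Suc.prems(1) that] cont_diff_part[OF Suc.prems(2) that]])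
    show "((\<lambda>s. F s z + G s z) has_vector_derivative part_t F t z + part_t G t z) (at t)"
      if "z \<in> extension k U" for t z
      by (rule has_vector_derivative_add[OF Suc.prems[THEN has_vector_derivative_part_t, OF that]])
    show "((\<lambda>s. F t (shift r i (s *\<^sub>R c) z) + G t (shift r i (s *\<^sub>R c) z))
        has_vector_derivative part c r i (F t) z + part c r i (G t) z) (at 0)"
      if "z \<in> extension k U" "r \<le> k" "c \<in> {1, \<i>}" for t z r i c
      by (rule has_vector_derivative_add[OF Suc.prems[THEN has_vector_derivative_part, OF that]])
  qed (rule assms)
qed

lemma cont_diff_mult:
  assumes "open U"
  shows "cont_diff n k U F \<Longrightarrow> cont_diff n k U G \<Longrightarrow> cont_diff n k U (\<lambda>t z. F t z * G t z)"
proof (induction n arbitrary: F G)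
  case 0
  then show ?case by (auto simp: case_prod_unfold intro: continuous_intros)
next
  case (Suc n)
  note cont = Suc.prems[THEN cont_diff_imp_continuous]
  \<comment> \<open>The product rule evaluates the undifferentiated factors at parameter
    \<open>s = 0\<close>, which has to be recognised as the point \<open>z\<close> itself.\<close>
  have shift_0: "shift r i (0 *\<^sub>R c) z = z" for r i c and z :: "'a jet"
    by (auto simp: shift_def axis_def vec_eq_iff)
  show ?case
  proof (rule cont_diff_SucI[where D = "\<lambda>t z. F t z * part_t G t z + part_t F t z * G t z"
        and E = "\<lambda>c r i t z. F t z * part c r i (G t) z + part c r i (F t) z * G t z"])
    show "((\<lambda>s. F t (shift r i (s *\<^sub>R c) z) * G t (shift r i (s *\<^sub>R c) z))
        has_vector_derivative F t z * part c r i (G t) z + part c r i (F t) z * G t z) (at 0)"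
      if "z \<in> extension k U" "r \<le> k" "c \<in> {1, \<i>}" for t z r i c
      using has_vector_derivative_mult[OF has_vector_derivative_part[OF Suc.prems(1) that]
          has_vector_derivative_part[OF Suc.prems(2) that], of t i t i]
      unfolding shift_0 .
    show "((\<lambda>s. F s z * G s z) has_vector_derivative F t z * part_t G t z + part_t F t z * G t z) (at t)"
      if "z \<in> extension k U" for t z
      using has_vector_derivative_part_t[OF Suc.prems(1) that]
        has_vector_derivative_part_t[OF Suc.prems(2) that]
      by (rule has_vector_derivative_mult)
    show "continuous_on (UNIV \<times> extension k U) (\<lambda>(t, z). F t z * G t z)"
      using continuous_on_mult[OF cont] by (simp add: case_prod_unfold)
    \<comment> \<open>The Leibniz terms contain \<open>F\<close> and \<open>G\<close> themselves
      next to partials of order \<open>n\<close>, so both must first be lowered to order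
      \<open>n\<close>.\<close>
    note F = cont_diff_SucD[OF assms Suc.prems(1)] and G = cont_diff_SucD[OF assms Suc.prems(2)]
    show "cont_diff n k U (\<lambda>t z. F t z * part_t G t z + part_t F t z * G t z)"
      by (rule cont_diff_add[OF assms Suc.IH[OF F cont_diff_part_t[OF Suc.prems(2)]]
            Suc.IH[OF cont_diff_part_t[OF Suc.prems(1)] G]])
    show "cont_diff n k U (\<lambda>t z. F t z * part c r i (G t) z + part c r i (F t) z * G t z)"
      if "r \<le> k" "c \<in> {1, \<i>}" for c r i
      by (rule cont_diff_add[OF assms Suc.IH[OF F cont_diff_part[OF Suc.prems(2) that]]
            Suc.IH[OF cont_diff_part[OF Suc.prems(1) that] G]])
  qed (rule assms)
qed

lemma cont_diff_sum:
  assumes "open U" "\<And>x. x \<in> A \<Longrightarrow> cont_diff n k U (F x)"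
  shows "cont_diff n k U (\<lambda>t z. \<Sum>x\<in>A. F x t z)"
  using assms(2)
  by (induction A rule: infinite_finite_induct) (auto intro: cont_diff_const cont_diff_add assms(1))

section \<open>Pullback along the projection\<close>

lemma proj_shift:
  "proj k (shift r i w z) = (if r \<le> k then shift r i w (proj k z) else proj k z)"
  by (auto simp: proj_def shift_def fun_eq_iff)

lemma proj_in_extension: "z \<in> extension k' U \<Longrightarrow> proj k z \<in> extension k U"
  by (auto simp: proj_def extension_def)

lemma continuous_on_proj:
  assumes "continuous_on (UNIV \<times> extension k U) (\<lambda>(t, z). F t z)"
  shows "continuous_on (UNIV \<times> extension k' U) (\<lambda>(t::real, z). F t (proj k z))"
proof -
  have "continuous_on (UNIV \<times> extension k' U) (\<lambda>p. proj k (snd p))"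
  proof (rule continuous_on_coordinatewise_then_product)
    show "continuous_on (UNIV \<times> extension k' U) (\<lambda>p. proj k (snd p) r)" for r
      unfolding proj_def
      by (cases "r \<le> k")
         (simp_all add: continuous_on_product_then_coordinatewise[OF continuous_on_snd])
  qed
  then have "continuous_on (UNIV \<times> extension k' U) (\<lambda>p. (fst p, proj k (snd p)))"
    by (rule continuous_on_Pair[OF continuous_on_fst[OF continuous_on_id]])
  from continuous_on_compose2[OF assms this] show ?thesis
    by (simp add: case_prod_unfold proj_in_extension image_subset_iff)
qed

text \<open>The chain rule is trivial here: \<open>proj k\<close> passes shifts of order at most
  \<open>k\<close> through and forgets the others. Each spatial partial of the pullback is thus the
  pullback of a partial, or zero. The lift uses this with \<open>k' = Suc k\<close>.\<close>

lemma cont_diff_proj: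
  assumes "open U"
  shows "cont_diff n k U F \<Longrightarrow> cont_diff n k' U (\<lambda>t z. F t (proj k z))"
proof (induction n arbitrary: F)
  case 0
  then show ?case by (simp add: continuous_on_proj)
next
  case (Suc n)
  show ?case
  proof (rule cont_diff_SucI[where D = "\<lambda>t z. part_t F t (proj k z)"
        and E = "\<lambda>c r i t z. if r \<le> k then part c r i (F t) (proj k z) else 0"])
    show "((\<lambda>s. F t (proj k (shift r i (s *\<^sub>R c) z))) has_vector_derivative
        (if r \<le> k then part c r i (F t) (proj k z) else 0)) (at 0)"
      if "z \<in> extension k' U" "c \<in> {1, \<i>}" for t z r i c
      using has_vector_derivative_part[OF Suc.prems proj_in_extension[OF that(1)] _ that(2)]
      by (auto simp: proj_shift)
    show "cont_diff n k' U (\<lambda>t z. if r \<le> k then part c r i (F t) (proj k z) else 0)"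
      if "c \<in> {1, \<i>}" for r i c
      using Suc.IH[OF cont_diff_part[OF Suc.prems _ that]] by (cases "r \<le> k") (auto simp: cont_diff_const)
  qed (auto intro!: assms has_vector_derivative_part_t[OF Suc.prems] proj_in_extension
        Suc.IH cont_diff_part_t[OF Suc.prems]
        continuous_on_proj[OF cont_diff_imp_continuous[OF Suc.prems]])
qed

section \<open>Time slices, Wirtinger derivatives and smoothness of the complete lift\<close>

lemma continuous_on_fix_time:
  assumes "continuous_on (UNIV \<times> extension k U) (\<lambda>(t, z). F t z)"
  shows "continuous_on (UNIV \<times> extension k U) (\<lambda>(_::real, z). F t z)"
proof -
  have "continuous_on (UNIV \<times> extension k U) (\<lambda>p::real \<times> _. (t, snd p))"
    by (intro continuous_intros)
  from continuous_on_compose2[OF assms this] show ?thesis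
    by (simp add: case_prod_unfold image_subset_iff)
qed

text \<open>The Hamiltonian field is taken at one time \<open>t\<close>, while \<open>smooth\<close>
  tests the extension of a function that is constant in time. Freezing \<open>t\<close> makes the
  time derivative zero and turns the spatial partials into their own time slices.\<close>

lemma cont_diff_fix_time:
  assumes "open U"
  shows "cont_diff n k U F \<Longrightarrow> cont_diff n k U (\<lambda>_. F t)"
proof (induction n arbitrary: F)
  case 0
  then show ?case by (simp add: continuous_on_fix_time)
next
  case (Suc n)
  show ?case
    by (rule cont_diff_SucI[where D = "\<lambda>_ _. 0" and E = "\<lambda>c r i _. part c r i (F t)"])
       (intro assms continuous_on_fix_time cont_diff_imp_continuous[OF Suc.prems] cont_diff_const
          has_vector_derivative_const has_vector_derivative_part[OF Suc.prems] Suc.IH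
          cont_diff_part[OF Suc.prems]; assumption)+
qed

lemma cont_diff_part_z:
  assumes "open U" "cont_diff (Suc n) k U F" "r \<le> k"
  shows "cont_diff n k U (\<lambda>t. part_z r i (F t))" "cont_diff n k U (\<lambda>t. part_zbar r i (F t))"
proof -
  \<comment> \<open>Both Wirtinger derivatives have this form, with \<open>a = - \<i> / 2\<close>
    for \<open>part_z\<close> and \<open>a = \<i> / 2\<close> for \<open>part_zbar\<close>.\<close>
  have "cont_diff n k U (\<lambda>t z. 1 / 2 * part 1 r i (F t) z + a * part \<i> r i (F t) z)" for a
    by (intro cont_diff_add cont_diff_mult cont_diff_const cont_diff_part assms) auto
  from this[of "- \<i> / 2"] this[of "\<i> / 2"]
  show "cont_diff n k U (\<lambda>t. part_z r i (F t))" "cont_diff n k U (\<lambda>t. part_zbar r i (F t))"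
    by (simp_all add: part_z_def[abs_def] part_zbar_def[abs_def] field_simps)
qed

text \<open>Each step of the lift differentiates once, so order \<open>n\<close> of the next lift
  costs order \<open>Suc n\<close> of the previous one. The induction closes because smoothness
  provides every order.\<close>

lemma smooth_time_complete_lift:
  assumes "open U" "smooth_time 0 U (on_base H)"
  shows "smooth_time k U (complete_lift k H)"
proof (induction k)
  case 0
  show ?case using assms(2) by simp
next
  case (Suc k)
  have C: "cont_diff n k U (complete_lift k H)" for n
    using Suc by (simp add: smooth_time_def)
  note linear = cont_diff_linear_coordinate[OF assms(1) bounded_linear_ident]
    cont_diff_linear_coordinate[OF assms(1) bounded_linear_cnj]
  show ?case
    unfolding smooth_time_def complete_lift.simps
    by (intro allI cont_diff_add cont_diff_sum cont_diff_mult cont_diff_time linear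
        cont_diff_proj[OF assms(1), of _ k "part_t (complete_lift k H)"]
        cont_diff_proj[OF assms(1), of _ k "\<lambda>t. part_z r i (complete_lift k H t)" for r i]
        cont_diff_proj[OF assms(1), of _ k "\<lambda>t. part_zbar r i (complete_lift k H t)" for r i]
        cont_diff_part_t[OF C] cont_diff_part_z[OF assms(1) C] assms(1)) auto
qed

section \<open>Linear algebra of the Hamiltonian equation\<close>

lemma tangent_vec_of_components: "vec_of_components k a b \<in> tangent k"
  by (simp add: tangent_def vec_of_components_def)

text \<open>Nondegeneracy of the form at a single point. For \<open>u = (a, b)\<close> the
  contraction has coefficients \<open>- \<i> * b r $ i\<close> along \<open>dz r i\<close> and
  \<open>\<i> * a r $ i\<close> along \<open>dzbar r i\<close>; comparing them with those of the
  differential determines \<open>a\<close> and \<open>b\<close>.\<close>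

lemma hamiltonian_equation_iff:
  assumes "u \<in> tangent k"
  shows "(\<forall>v \<in> tangent k. interior u (Phi k) v = differential k f z v) \<longleftrightarrow>
    u = vec_of_components k (\<lambda>r i. 1 / \<i> * part_zbar r i f z) (\<lambda>r i. - (1 / \<i> * part_z r i f z))"
    (is "?L \<longleftrightarrow> ?R")
proof
  assume eq: ?L
  \<comment> \<open>The pairs \<open>(e r i, 0)\<close> and \<open>(0, e r i)\<close> are the
    coordinate vectors along z and its conjugate. They may be tested separately because the two
    components of a complex tangent vector are independent.\<close>
  define e :: "nat \<Rightarrow> 'a \<Rightarrow> 'a jet" where "e r i = (\<lambda>_. 0)(r := axis i 1)" for r i
  have e_nth: "e r i q $ j = (if q = r then if j = i then 1 else 0 else 0)" for r i q j
    by (simp add: e_def axis_def)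
  have collapse: "(\<Sum>q\<le>k. \<Sum>j\<in>UNIV. g q j * e r i q $ j) = g r i"
    if "r \<le> k" for r i and g :: "nat \<Rightarrow> 'a \<Rightarrow> complex"
  proof -
    have "(\<Sum>q\<le>k. \<Sum>j\<in>UNIV. g q j * e r i q $ j) = (\<Sum>q\<le>k. if q = r then g r i else 0)"
      by (intro sum.cong refl) (simp add: e_nth if_distrib[of "\<lambda>x. _ * x"] cong: if_cong)
    then show ?thesis using that by simp
  qed
  have comp: "- \<i> * snd u r $ i = part_z r i f z" "\<i> * fst u r $ i = part_zbar r i f z"
    if r: "r \<le> k" for r i
  proof -
    have "(e r i, \<lambda>_. 0) \<in> tangent k" "(\<lambda>_. 0, e r i) \<in> tangent k"
      using r by (auto simp: tangent_def e_def)
    from eq[rule_format, OF this(1)] eq[rule_format, OF this(2)]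
    show "- \<i> * snd u r $ i = part_z r i f z" "\<i> * fst u r $ i = part_zbar r i f z"
      by (simp_all add: interior_def Phi_def wedge_def differential_def dz_def dzbar_def
          sum_negf collapse[OF r] mult.commute[of "e r i _ $ _"])
  qed
  show ?R
  \<comment> \<open>Up to order \<open>k\<close> the components come from \<open>comp\<close>;
    beyond \<open>k\<close> both sides vanish, on the left because \<open>u\<close> is tangent and
    on the right by the default value in \<open>vec_of_components\<close>.\<close>
  proof (rule prod_eqI; rule ext)
    fix r
    show "fst u r = fst (vec_of_components k (\<lambda>r i. 1 / \<i> * part_zbar r i f z)
        (\<lambda>r i. - (1 / \<i> * part_z r i f z))) r"
      using assms by (auto simp: vec_of_components_def tangent_def vec_eq_iff simp flip: comp)
    show "snd u r = snd (vec_of_components k (\<lambda>r i. 1 / \<i> * part_zbar r i f z)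
        (\<lambda>r i. - (1 / \<i> * part_z r i f z))) r"
      using assms by (auto simp: vec_of_components_def tangent_def vec_eq_iff simp flip: comp)
  qed
next
  assume ?R
  then show ?L
    by (auto simp: interior_def Phi_def wedge_def differential_def dz_def dzbar_def
        vec_of_components_def sum_distrib_left algebra_simps intro!: sum.cong)
qed

theorem proposition2:
  fixes U :: "(complex ^ 'm) set"
    and H :: "real \<Rightarrow> complex ^ 'm \<Rightarrow> complex"
    and Z :: "'m jet \<Rightarrow> 'm tvec"
    and k :: nat and t :: real
  assumes "open U"
    and "smooth_time 0 U (on_base H)"
  shows "hamiltonian_field k U (complete_lift k H t) Z \<longleftrightarrow>
    (\<forall>z \<in> extension k U. Z z = vec_of_components k
       (\<lambda>r i. 1 / \<i> * part_zbar r i (complete_lift k H t) z)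
       (\<lambda>r i. - (1 / \<i> * part_z r i (complete_lift k H t) z)))"
    (is "?L \<longleftrightarrow> (\<forall>z \<in> extension k U. Z z = ?X z)")
proof
  assume ?L
  then show "\<forall>z \<in> extension k U. Z z = ?X z"
    unfolding hamiltonian_field_def vector_field_def by (metis hamiltonian_equation_iff)
next
  assume Z: "\<forall>z \<in> extension k U. Z z = ?X z"
  have C: "cont_diff n k U (complete_lift k H)" for n
    using smooth_time_complete_lift[OF assms] by (simp add: smooth_time_def)
  \<comment> \<open>A Hamiltonian field must be a smooth vector field, so the converse has to derive
    the smoothness of the prescribed components from that of the lift.\<close>
  have "smooth k U (\<lambda>z. fst (Z z) r $ i) \<and> smooth k U (\<lambda>z. snd (Z z) r $ i)"
    if r: "r \<le> k" for r i
    unfolding smooth_def smooth_time_def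
  proof (intro conjI allI)
    fix n
    have mult: "cont_diff n k U (\<lambda>_ z. a * g t z)"
      if "cont_diff n k U g" for a and g :: "real \<Rightarrow> 'm jet \<Rightarrow> complex"
      by (intro cont_diff_mult cont_diff_const cont_diff_fix_time that assms(1))
    note parts = cont_diff_part_z[OF assms(1) C r]
    show "cont_diff n k U (\<lambda>_ z. fst (Z z) r $ i)"
      \<comment> \<open>\<open>Z\<close> is prescribed on the extension only, so the regularity of
        the formula reaches its components through \<open>cont_diff_cong\<close>.\<close>
      using assms(1) mult[OF parts(2), of "1 / \<i>" i]
      by (rule cont_diff_cong) (use Z r in \<open>simp add: vec_of_components_def\<close>)
    show "cont_diff n k U (\<lambda>_ z. snd (Z z) r $ i)"
      using assms(1) mult[OF parts(1), of "- (1 / \<i>)" i]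
      by (rule cont_diff_cong) (use Z r in \<open>simp add: vec_of_components_def\<close>)
  qed
  then show ?L
    using Z by (simp add: hamiltonian_field_def vector_field_def tangent_vec_of_components
        hamiltonian_equation_iff[OF tangent_vec_of_components])
qed

end
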